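(* Let $\{X_k\}_{k=1}^\infty$ be a martingale difference sequence with respect to its own filtration, and suppose there is $M>0$ such that $\mathbb E X_1^2\le M$ and $\mathbb E[X_k^2\mid X_1,\dots,X_{k-1}]\le M$ almost surely for all $k\ge2$. Then, for every $p\ge1$ and all real $p\times p$ matrices $A$ with zero diagonal, $$\mathbb E|\mathbf x_p^\top A\mathbf x_p|^2\le 2M^2\,\mathrm{tr}(AA^\top).$$
   Context: $\mathbf x_p=(X_1,\dots,X_p)$, regarded as a column vector in $\mathbb R^p$. A martingale difference sequence with respect to its own filtration means: each $X_k$ is integrable, $\mathbb E X_1=0$ and $\mathbb E[X_k\mid X_1,\dots,X_{k-1}]=0$ a.s. for $k\ge2$. *)

theory Defs
  imports "HOL-Probability.Probability" "Jordan_Normal_Form.Matrix"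
begin

text \<open>
  Sequences of random variables are functions on \<open>nat\<close> of which only the values at the indices
  \<open>1, 2, \<dots>\<close> are used.
\<close>

definition past_algebra :: "'a measure \<Rightarrow> (nat \<Rightarrow> 'a \<Rightarrow> real) \<Rightarrow> nat \<Rightarrow> 'a measure" where
  \<comment> \<open>the sigma-algebra generated by \<open>X 1, \<dots>, X (k - 1)\<close>\<close>
  "past_algebra P X k =
     sigma (space P) (\<Union>i\<in>{1..<k}. {X i -` B \<inter> space P | B. B \<in> sets borel})"

definition martingale_difference :: "'a measure \<Rightarrow> (nat \<Rightarrow> 'a \<Rightarrow> real) \<Rightarrow> bool" where
  "martingale_difference P X \<longleftrightarrow>
     (\<forall>k\<ge>1. integrable P (X k)) \<and>
     (\<integral>\<omega>. X 1 \<omega> \<partial>P) = 0 \<and>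
     (\<forall>k\<ge>2. AE \<omega> in P. real_cond_exp P (past_algebra P X k) (X k) \<omega> = 0)"

definition sample_vec :: "(nat \<Rightarrow> 'a \<Rightarrow> real) \<Rightarrow> nat \<Rightarrow> 'a \<Rightarrow> real vec" where
  \<comment> \<open>vector indices start at 0, those of the sequence at 1\<close>
  "sample_vec X p \<omega> = Matrix.vec p (\<lambda>i. X (Suc i) \<omega>)"

definition mat_trace :: "'b::comm_monoid_add mat \<Rightarrow> 'b" where
  "mat_trace A = (\<Sum>i<dim_row A. A $$ (i, i))"

end

theory Submission
  imports Defs
begin

text \<open>
  Grouping the terms of the quadratic form by their larger index writes it as a martingale transform
  \<open>\<Sum>k. X\<^sub>k L\<^sub>k\<close> with predictable weights \<open>L\<^sub>k = \<Sum>i<k. (a\<^sub>k\<^sub>i + a\<^sub>i\<^sub>k) X\<^sub>i\<close>. The summands of a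
  martingale transform are orthogonal in \<open>L\<^sup>2\<close>, so its second moment is at most \<open>M * (\<Sum>k. E L\<^sub>k\<^sup>2)\<close>.
  Each \<open>L\<^sub>k\<close> is itself a martingale transform with constant weights, whence
  \<open>E L\<^sub>k\<^sup>2 \<le> M * (\<Sum>i<k. (a\<^sub>k\<^sub>i + a\<^sub>i\<^sub>k)\<^sup>2)\<close>; finally \<open>(a + b)\<^sup>2 \<le> 2 * (a\<^sup>2 + b\<^sup>2)\<close>.
\<close>

section \<open>Elementary facts on double sums and products\<close>

text \<open>Enlarging the square by one adds a row, a column and a corner that vanishes. The
  regrouping is used both for the quadratic form and for the sum of the squared entries.\<close>

lemma sum_square_zero_diagonal:
  fixes f :: "nat \<Rightarrow> nat \<Rightarrow> 'b::comm_monoid_add"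
  assumes "\<And>i. i < n \<Longrightarrow> f i i = 0"
  shows "(\<Sum>i<n. \<Sum>j<n. f i j) = (\<Sum>k<n. \<Sum>i<k. f k i + f i k)"
  using assms by (induction n) (simp_all add: sum.distrib ac_simps)

text \<open>The product is dominated by the sum of the squares. This gives the integrability of the
  cross term in the orthogonality argument.\<close>

lemma integrable_mult_of_squares:
  fixes f g :: "'a \<Rightarrow> real"
  assumes [measurable]: "f \<in> borel_measurable N" "g \<in> borel_measurable N"
    and "integrable N (\<lambda>x. (f x)\<^sup>2)" "integrable N (\<lambda>x. (g x)\<^sup>2)"
  shows "integrable N (\<lambda>x. f x * g x)"
proof (rule Bochner_Integration.integrable_bound)
  show "integrable N (\<lambda>x. (f x)\<^sup>2 + (g x)\<^sup>2)"
    using assms by simp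
  have "\<bar>a * b\<bar> \<le> a\<^sup>2 + b\<^sup>2" for a b :: real
    using sum_squares_bound[of a b] sum_squares_bound[of a "-b"] by (simp add: abs_le_iff)
  then show "AE x in N. norm (f x * g x) \<le> norm ((f x)\<^sup>2 + (g x)\<^sup>2)"
    by simp
qed simp

section \<open>The filtration generated by the sequence\<close>

lemma space_past_algebra [simp]: "space (past_algebra P X k) = space P"
  by (simp add: past_algebra_def space_measure_of_conv)

lemma sets_past_algebra:
  "sets (past_algebra P X k) =
     sigma_sets (space P) (\<Union>i\<in>{1..<k}. {X i -` B \<inter> space P | B. B \<in> sets borel})"
  unfolding past_algebra_def by (rule sets_measure_of) auto

lemma measurable_past_algebra:
  assumes "1 \<le> i" "i < k"
  shows "X i \<in> borel_measurable (past_algebra P X k)"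
proof (rule measurableI)
  fix B :: "real set"
  assume "B \<in> sets borel"
  then show "X i -` B \<inter> space (past_algebra P X k) \<in> sets (past_algebra P X k)"
    using assms unfolding sets_past_algebra space_past_algebra
    by (intro sigma_sets.Basic UN_I[of i]) auto
qed simp

lemma subalgebra_past_algebra:
  assumes "\<And>i. 1 \<le> i \<Longrightarrow> X i \<in> borel_measurable P"
  shows "subalgebra P (past_algebra P X k)"
  unfolding subalgebra_def sets_past_algebra space_past_algebra
  using assms by (intro conjI refl sets.sigma_sets_subset) (auto intro: measurable_sets)

lemma subalgebra_past_algebra_mono:
  assumes "k \<le> l"
  shows "subalgebra (past_algebra P X l) (past_algebra P X k)"
  unfolding subalgebra_def sets_past_algebra space_past_algebra
  using assms by (intro conjI refl sigma_sets_subseteq UN_mono) auto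

text \<open>At index 1 there are no generators. The hypotheses on \<open>X 1\<close> are
  unconditional, so this index is always treated separately, through triviality of its past.\<close>

lemma sets_past_algebra_1: "sets (past_algebra P X (Suc 0)) = {{}, space P}"
  by (simp add: sets_past_algebra sigma_sets_empty_eq)

text \<open>Singletons are closed in a T1 space, so the preimage of \<open>{f y}\<close> is empty or
  everything, and it contains \<open>y\<close>.\<close>

lemma measurable_past_algebra_1_constant:
  fixes f :: "'a \<Rightarrow> 'b::t1_space"
  assumes "f \<in> borel_measurable (past_algebra P X (Suc 0))" "x \<in> space P" "y \<in> space P"
  shows "f x = f y"
proof -
  have "f -` {f y} \<inter> space P \<in> {{}, space P}"
    using measurable_sets[OF assms(1), of "{f y}"] by (simp add: sets_past_algebra_1)
  with assms(2,3) show ?thesis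
    by auto
qed

section \<open>Martingale differences with bounded conditional second moments\<close>

text \<open>The second-moment bounds use extended nonnegative integrals, so square integrability is
  derived from them and no default value of a divergent real integral can interfere.\<close>

locale bounded_martingale_difference = prob_space P for P :: "'a measure" +
  fixes X :: "nat \<Rightarrow> 'a \<Rightarrow> real" and M :: real
  assumes mds: "martingale_difference P X"
    and M_nonneg: "M \<ge> 0"
    and second_moment_1: "(\<integral>\<^sup>+\<omega>. ennreal ((X 1 \<omega>)\<^sup>2) \<partial>P) \<le> ennreal M"
    and cond_second_moment: "\<And>k. k \<ge> 2 \<Longrightarrow> AE \<omega> in P.
           nn_cond_exp P (past_algebra P X k) (\<lambda>\<omega>'. ennreal ((X k \<omega>')\<^sup>2)) \<omega> \<le> ennreal M"
begin

lemma measurable_X: "1 \<le> k \<Longrightarrow> X k \<in> borel_measurable P"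
  using mds by (auto simp: martingale_difference_def)

lemma subalgebra_past: "subalgebra P (past_algebra P X k)"
  by (intro subalgebra_past_algebra measurable_X)

lemma finite_measure_subalgebra_past: "finite_measure_subalgebra P (past_algebra P X k)"
  by unfold_locales (rule subalgebra_past)

text \<open>A factor known from the past can be pulled out of the conditional expectation of
  \<open>X (Suc k)\<close>, which is zero. For \<open>k = 0\<close> the factor is constant and
  \<open>X 1\<close> has mean zero.\<close>

lemma integral_past_mult_X:
  assumes H: "H \<in> borel_measurable (past_algebra P X (Suc k))"
    and int: "integrable P (\<lambda>\<omega>. H \<omega> * X (Suc k) \<omega>)"
  shows "(\<integral>\<omega>. H \<omega> * X (Suc k) \<omega> \<partial>P) = 0"
proof (cases k)
  case 0
  obtain z where z: "z \<in> space P"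
    using not_empty by auto
  have "(\<integral>\<omega>. H \<omega> * X 1 \<omega> \<partial>P) = (\<integral>\<omega>. H z * X 1 \<omega> \<partial>P)"
    using H z 0
    by (intro Bochner_Integration.integral_cong refl)
      (metis measurable_past_algebra_1_constant)
  then show ?thesis
    using 0 mds by (simp add: martingale_difference_def)
next
  case (Suc m)
  interpret F: finite_measure_subalgebra P "past_algebra P X (Suc k)"
    by (rule finite_measure_subalgebra_past)
  have ae: "AE \<omega> in P. real_cond_exp P (past_algebra P X (Suc k)) (X (Suc k)) \<omega> = 0"
    using mds Suc by (auto simp: martingale_difference_def)
  have "(\<integral>\<omega>. H \<omega> * X (Suc k) \<omega> \<partial>P) =
      (\<integral>\<omega>. H \<omega> * real_cond_exp P (past_algebra P X (Suc k)) (X (Suc k)) \<omega> \<partial>P)"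
    by (intro F.real_cond_exp_intg(2)[symmetric] int H measurable_X) simp
  also have "\<dots> = 0"
    using ae by (intro integral_eq_zero_AE) auto
  finally show ?thesis .
qed

text \<open>Again the past factor is pulled out, now from the conditional second moment.
  \<open>H\<close> is \<open>ennreal\<close>-valued, so the estimate can itself serve to prove
  integrability.\<close>

lemma nn_integral_past_mult_X_square:
  assumes H: "H \<in> borel_measurable (past_algebra P X (Suc k))"
  shows "(\<integral>\<^sup>+\<omega>. H \<omega> * ennreal ((X (Suc k) \<omega>)\<^sup>2) \<partial>P) \<le> ennreal M * (\<integral>\<^sup>+\<omega>. H \<omega> \<partial>P)"
proof (cases k)
  case 0
  obtain z where z: "z \<in> space P"
    using not_empty by auto
  have const: "H \<omega> = H z" if "\<omega> \<in> space P" for \<omega>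
    using H z 0 that by (metis measurable_past_algebra_1_constant)
  have [measurable]: "X (Suc 0) \<in> borel_measurable P"
    by (rule measurable_X) simp
  have "(\<integral>\<^sup>+\<omega>. H \<omega> * ennreal ((X 1 \<omega>)\<^sup>2) \<partial>P) = (\<integral>\<^sup>+\<omega>. H z * ennreal ((X 1 \<omega>)\<^sup>2) \<partial>P)"
    by (intro nn_integral_cong) (simp add: const)
  also have "\<dots> = H z * (\<integral>\<^sup>+\<omega>. ennreal ((X 1 \<omega>)\<^sup>2) \<partial>P)"
    by (simp add: nn_integral_cmult)
  also have "\<dots> \<le> H z * ennreal M"
    by (intro mult_left_mono second_moment_1) simp
  also have "\<dots> = ennreal M * (\<integral>\<^sup>+\<omega>. H z \<partial>P)"
    by (simp add: emeasure_space_1 mult.commute)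
  also have "(\<integral>\<^sup>+\<omega>. H z \<partial>P) = (\<integral>\<^sup>+\<omega>. H \<omega> \<partial>P)"
    by (intro nn_integral_cong) (simp add: const)
  finally show ?thesis
    using 0 by simp
next
  case (Suc m)
  interpret F: finite_measure_subalgebra P "past_algebra P X (Suc k)"
    by (rule finite_measure_subalgebra_past)
  have [measurable]: "X (Suc k) \<in> borel_measurable P"
    by (rule measurable_X) simp
  have [measurable]: "H \<in> borel_measurable P"
    by (rule measurable_from_subalg[OF subalgebra_past H])
  have ae: "AE \<omega> in P. nn_cond_exp P (past_algebra P X (Suc k))
      (\<lambda>\<omega>'. ennreal ((X (Suc k) \<omega>')\<^sup>2)) \<omega> \<le> ennreal M"
    using Suc by (intro cond_second_moment) simp
  have "(\<integral>\<^sup>+\<omega>. H \<omega> * ennreal ((X (Suc k) \<omega>)\<^sup>2) \<partial>P) = (\<integral>\<^sup>+\<omega>. H \<omega> *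
      nn_cond_exp P (past_algebra P X (Suc k)) (\<lambda>\<omega>'. ennreal ((X (Suc k) \<omega>')\<^sup>2)) \<omega> \<partial>P)"
    by (intro F.nn_cond_exp_intg[symmetric] H) simp
  also have "\<dots> \<le> (\<integral>\<^sup>+\<omega>. ennreal M * H \<omega> \<partial>P)"
    using ae by (intro nn_integral_mono_AE) (auto simp: mult.commute[of "ennreal M"] mult_left_mono)
  also have "\<dots> = ennreal M * (\<integral>\<^sup>+\<omega>. H \<omega> \<partial>P)"
    by (simp add: nn_integral_cmult)
  finally show ?thesis .
qed

text \<open>The extended bound with weight \<open>H\<close>-squared is finite; this yields
  integrability first, and then the same bound for the real integral.\<close>

lemma past_mult_X_square:
  assumes H: "H \<in> borel_measurable (past_algebra P X (Suc k))"
    and int: "integrable P (\<lambda>\<omega>. (H \<omega>)\<^sup>2)"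
  shows "integrable P (\<lambda>\<omega>. (X (Suc k) \<omega> * H \<omega>)\<^sup>2)"
    and "(\<integral>\<omega>. (X (Suc k) \<omega> * H \<omega>)\<^sup>2 \<partial>P) \<le> M * (\<integral>\<omega>. (H \<omega>)\<^sup>2 \<partial>P)"
proof -
  have [measurable]: "X (Suc k) \<in> borel_measurable P"
    by (rule measurable_X) simp
  have [measurable]: "H \<in> borel_measurable P"
    by (rule measurable_from_subalg[OF subalgebra_past H])
  have "(\<integral>\<^sup>+\<omega>. ennreal ((X (Suc k) \<omega> * H \<omega>)\<^sup>2) \<partial>P) =
      (\<integral>\<^sup>+\<omega>. ennreal ((H \<omega>)\<^sup>2) * ennreal ((X (Suc k) \<omega>)\<^sup>2) \<partial>P)"
    by (intro nn_integral_cong) (simp add: power_mult_distrib mult.commute flip: ennreal_mult)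
  also have "\<dots> \<le> ennreal M * (\<integral>\<^sup>+\<omega>. ennreal ((H \<omega>)\<^sup>2) \<partial>P)"
    using H by (intro nn_integral_past_mult_X_square borel_measurable_power measurable_compose_rev[OF measurable_ennreal])
  also have "\<dots> = ennreal (M * (\<integral>\<omega>. (H \<omega>)\<^sup>2 \<partial>P))"
    using int M_nonneg by (simp add: nn_integral_eq_integral ennreal_mult)
  finally have le: "(\<integral>\<^sup>+\<omega>. ennreal ((X (Suc k) \<omega> * H \<omega>)\<^sup>2) \<partial>P) \<le>
      ennreal (M * (\<integral>\<omega>. (H \<omega>)\<^sup>2 \<partial>P))" .
  show int': "integrable P (\<lambda>\<omega>. (X (Suc k) \<omega> * H \<omega>)\<^sup>2)"
    using le by (intro integrableI_nonneg) (auto intro: le_less_trans)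
  have "0 \<le> M * (\<integral>\<omega>. (H \<omega>)\<^sup>2 \<partial>P)"
    using M_nonneg by simp
  with le show "(\<integral>\<omega>. (X (Suc k) \<omega> * H \<omega>)\<^sup>2 \<partial>P) \<le> M * (\<integral>\<omega>. (H \<omega>)\<^sup>2 \<partial>P)"
    by (simp add: nn_integral_eq_integral[OF int'])
qed

section \<open>Second moments of martingale transforms\<close>

text \<open>The indices are shifted by one: summand \<open>k\<close> involves
  \<open>X (Suc k)\<close>, and the past at \<open>Suc n\<close> is generated by \<open>X 1\<close>
  up to \<open>X n\<close>.\<close>

lemma measurable_martingale_transform:
  assumes "\<And>k. k < n \<Longrightarrow> H k \<in> borel_measurable (past_algebra P X (Suc k))"
  shows "(\<lambda>\<omega>. \<Sum>k<n. X (Suc k) \<omega> * H k \<omega>) \<in> borel_measurable (past_algebra P X (Suc n))"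
proof (intro borel_measurable_sum borel_measurable_times)
  fix k
  assume "k \<in> {..<n}"
  then show "X (Suc k) \<in> borel_measurable (past_algebra P X (Suc n))"
    and "H k \<in> borel_measurable (past_algebra P X (Suc n))"
    using measurable_from_subalg[OF subalgebra_past_algebra_mono[of "Suc k" "Suc n" P X] assms[of k]]
    by (auto intro: measurable_past_algebra)
qed

text \<open>Induction on \<open>n\<close>: the new summand is orthogonal to the previous partial
  sum. Integrability is carried along because the cross term needs it at each step.\<close>

lemma martingale_transform_square:
  assumes "\<And>k. k < n \<Longrightarrow> H k \<in> borel_measurable (past_algebra P X (Suc k))"
    and "\<And>k. k < n \<Longrightarrow> integrable P (\<lambda>\<omega>. (H k \<omega>)\<^sup>2)"
  shows "integrable P (\<lambda>\<omega>. (\<Sum>k<n. X (Suc k) \<omega> * H k \<omega>)\<^sup>2) \<and>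
    (\<integral>\<omega>. (\<Sum>k<n. X (Suc k) \<omega> * H k \<omega>)\<^sup>2 \<partial>P) \<le> M * (\<Sum>k<n. \<integral>\<omega>. (H k \<omega>)\<^sup>2 \<partial>P)"
  using assms
proof (induction n)
  case 0
  then show ?case by simp
next
  case (Suc n)
  define S where "S = (\<lambda>\<omega>. \<Sum>k<n. X (Suc k) \<omega> * H k \<omega>)"
  define Y where "Y = (\<lambda>\<omega>. X (Suc n) \<omega> * H n \<omega>)"
  have IH: "integrable P (\<lambda>\<omega>. (S \<omega>)\<^sup>2)"
      "(\<integral>\<omega>. (S \<omega>)\<^sup>2 \<partial>P) \<le> M * (\<Sum>k<n. \<integral>\<omega>. (H k \<omega>)\<^sup>2 \<partial>P)"
    using Suc by (auto simp: S_def)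
  have S: "S \<in> borel_measurable (past_algebra P X (Suc n))"
    unfolding S_def using Suc.prems by (intro measurable_martingale_transform) auto
  have H: "H n \<in> borel_measurable (past_algebra P X (Suc n))"
    using Suc.prems by auto
  have Y: "integrable P (\<lambda>\<omega>. (Y \<omega>)\<^sup>2)" "(\<integral>\<omega>. (Y \<omega>)\<^sup>2 \<partial>P) \<le> M * (\<integral>\<omega>. (H n \<omega>)\<^sup>2 \<partial>P)"
    unfolding Y_def using Suc.prems by (auto intro!: past_mult_X_square)
  have meas: "S \<in> borel_measurable P" "Y \<in> borel_measurable P"
    unfolding Y_def using measurable_from_subalg[OF subalgebra_past S]
      measurable_from_subalg[OF subalgebra_past H] measurable_X[of "Suc n"] by auto
  have SY: "integrable P (\<lambda>\<omega>. S \<omega> * Y \<omega>)"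
    by (intro integrable_mult_of_squares meas IH Y)
  have SY0: "(\<integral>\<omega>. S \<omega> * Y \<omega> \<partial>P) = 0"
    \<comment> \<open>Both \<open>S\<close> and \<open>H n\<close> are known before
      \<open>X (Suc n)\<close>, so their product is an admissible past factor.\<close>
    using integral_past_mult_X[of "\<lambda>\<omega>. S \<omega> * H n \<omega>" n] S H SY by (simp add: Y_def ac_simps)
  have eq: "(\<Sum>k<Suc n. X (Suc k) \<omega> * H k \<omega>)\<^sup>2 = (S \<omega>)\<^sup>2 + (Y \<omega>)\<^sup>2 + 2 * (S \<omega> * Y \<omega>)" for \<omega>
    by (simp add: S_def Y_def power2_sum)
  show ?case
    unfolding eq using IH Y SY SY0 by (simp add: distrib_left)
qed

text \<open>Constants are measurable for every past, and on a probability space the second moment of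
  a constant is its square.\<close>

lemma linear_form_square:
  shows "integrable P (\<lambda>\<omega>. (\<Sum>i<n. X (Suc i) \<omega> * c i)\<^sup>2)"
    and "(\<integral>\<omega>. (\<Sum>i<n. X (Suc i) \<omega> * c i)\<^sup>2 \<partial>P) \<le> M * (\<Sum>i<n. (c i)\<^sup>2)"
  using martingale_transform_square[of n "\<lambda>i \<omega>. c i"] by (simp_all add: prob_space)

lemma quadratic_form_square:
  fixes a :: "nat \<Rightarrow> nat \<Rightarrow> real"
  assumes "\<And>i. i < p \<Longrightarrow> a i i = 0"
  defines "Q \<equiv> \<lambda>\<omega>. \<Sum>i<p. \<Sum>j<p. a i j * X (Suc i) \<omega> * X (Suc j) \<omega>"
  shows "integrable P (\<lambda>\<omega>. (Q \<omega>)\<^sup>2)"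
    and "(\<integral>\<omega>. (Q \<omega>)\<^sup>2 \<partial>P) \<le> 2 * M\<^sup>2 * (\<Sum>i<p. \<Sum>j<p. (a i j)\<^sup>2)"
proof -
  define c where "c k i = a k i + a i k" for k i
  define L where "L k \<omega> = (\<Sum>i<k. X (Suc i) \<omega> * c k i)" for k \<omega>
  have Q: "Q \<omega> = (\<Sum>k<p. X (Suc k) \<omega> * L k \<omega>)" for \<omega>
    unfolding Q_def using assms(1)
    by (subst sum_square_zero_diagonal)
      (simp_all add: L_def c_def sum_distrib_left algebra_simps)
  \<comment> \<open>\<open>L k\<close> involves only \<open>X 1\<close> up to \<open>X k\<close>, so
    it is an admissible weight for \<open>X (Suc k)\<close>.\<close>
  have "L k \<in> borel_measurable (past_algebra P X (Suc k))" for k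
    unfolding L_def by (intro measurable_martingale_transform) simp
  then have transform: "integrable P (\<lambda>\<omega>. (Q \<omega>)\<^sup>2)"
      "(\<integral>\<omega>. (Q \<omega>)\<^sup>2 \<partial>P) \<le> M * (\<Sum>k<p. \<integral>\<omega>. (L k \<omega>)\<^sup>2 \<partial>P)"
    using martingale_transform_square[of p L] by (simp_all add: Q L_def linear_form_square)
  show "integrable P (\<lambda>\<omega>. (Q \<omega>)\<^sup>2)"
    by (rule transform)
  note transform(2)
  \<comment> \<open>Bounding the second moment of each weight \<open>L k\<close> produces the second
    factor \<open>M\<close>.\<close>
  also have "M * (\<Sum>k<p. \<integral>\<omega>. (L k \<omega>)\<^sup>2 \<partial>P) \<le> M * (\<Sum>k<p. M * (\<Sum>i<k. (c k i)\<^sup>2))"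
    unfolding L_def by (intro mult_left_mono sum_mono linear_form_square M_nonneg)
  also have "\<dots> = M\<^sup>2 * (\<Sum>k<p. \<Sum>i<k. (c k i)\<^sup>2)"
    by (simp add: power2_eq_square sum_distrib_left mult.assoc)
  also have "\<dots> \<le> M\<^sup>2 * (\<Sum>k<p. \<Sum>i<k. 2 * ((a k i)\<^sup>2 + (a i k)\<^sup>2))"
  proof (intro mult_left_mono sum_mono)
    \<comment> \<open>This is where the constant 2 arises: twice the product of two reals is at most
      the sum of their squares.\<close>
    show "(c k i)\<^sup>2 \<le> 2 * ((a k i)\<^sup>2 + (a i k)\<^sup>2)" for k i
      using sum_squares_bound[of "a k i" "a i k"] by (simp add: c_def power2_sum)
  qed simp
  also have "\<dots> = 2 * M\<^sup>2 * (\<Sum>k<p. \<Sum>i<k. (a k i)\<^sup>2 + (a i k)\<^sup>2)"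
    by (simp only: sum_distrib_left ac_simps)
  \<comment> \<open>The initial regrouping is undone, now for the squared entries, which also vanish
    on the diagonal.\<close>
  also have "(\<Sum>k<p. \<Sum>i<k. (a k i)\<^sup>2 + (a i k)\<^sup>2) = (\<Sum>i<p. \<Sum>j<p. (a i j)\<^sup>2)"
    using assms(1) by (intro sum_square_zero_diagonal[symmetric]) simp
  finally show "(\<integral>\<omega>. (Q \<omega>)\<^sup>2 \<partial>P) \<le> 2 * M\<^sup>2 * (\<Sum>i<p. \<Sum>j<p. (a i j)\<^sup>2)" .
qed

end

section \<open>Translation into matrix notation\<close>

lemma mat_trace_mult_transpose:
  fixes A :: "'b::comm_semiring_1 mat"
  assumes "A \<in> carrier_mat m n"
  shows "mat_trace (A * transpose_mat A) = (\<Sum>i<m. \<Sum>j<n. (A $$ (i, j))\<^sup>2)"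
  using assms by (simp add: mat_trace_def scalar_prod_def atLeast0LessThan power2_eq_square)

lemma scalar_prod_sample_vec:
  assumes "A \<in> carrier_mat p p"
  shows "scalar_prod (sample_vec X p \<omega>) (A *\<^sub>v sample_vec X p \<omega>) =
    (\<Sum>i<p. \<Sum>j<p. A $$ (i, j) * X (Suc i) \<omega> * X (Suc j) \<omega>)"
  using assms
  by (simp add: sample_vec_def scalar_prod_def atLeast0LessThan sum_distrib_left ac_simps)

theorem theorem4p5:
  fixes P :: "'a measure" and X :: "nat \<Rightarrow> 'a \<Rightarrow> real" and M :: real
    and p :: nat and A :: "real mat"
  assumes "prob_space P"
    and "martingale_difference P X"
    and "M > 0"
    and "(\<integral>\<^sup>+\<omega>. ennreal ((X 1 \<omega>)\<^sup>2) \<partial>P) \<le> ennreal M"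
    and "\<forall>k\<ge>2. AE \<omega> in P.
           nn_cond_exp P (past_algebra P X k) (\<lambda>\<omega>'. ennreal ((X k \<omega>')\<^sup>2)) \<omega> \<le> ennreal M"
    and "p \<ge> 1"
    and "A \<in> carrier_mat p p"
    and "\<forall>i<p. A $$ (i, i) = 0"
  shows "(\<integral>\<^sup>+\<omega>. ennreal (\<bar>scalar_prod (sample_vec X p \<omega>) (A *\<^sub>v sample_vec X p \<omega>)\<bar>\<^sup>2) \<partial>P)
           \<le> ennreal (2 * M\<^sup>2 * mat_trace (A * transpose_mat A))"
proof -
  interpret bounded_martingale_difference P X M
    using assms(1-5)
    by (auto simp: bounded_martingale_difference_def bounded_martingale_difference_axioms_def)
  \<comment> \<open>Integrability lets the extended integral be replaced by the real one; a real
    integral that diverges is 0 by convention, and bounding it would say nothing.\<close>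
  have "integrable P (\<lambda>\<omega>. (\<Sum>i<p. \<Sum>j<p. A $$ (i, j) * X (Suc i) \<omega> * X (Suc j) \<omega>)\<^sup>2)"
    using assms(8) by (intro quadratic_form_square) simp
  then have "(\<integral>\<^sup>+\<omega>. ennreal (\<bar>scalar_prod (sample_vec X p \<omega>) (A *\<^sub>v sample_vec X p \<omega>)\<bar>\<^sup>2) \<partial>P) =
      ennreal (\<integral>\<omega>. (\<Sum>i<p. \<Sum>j<p. A $$ (i, j) * X (Suc i) \<omega> * X (Suc j) \<omega>)\<^sup>2 \<partial>P)"
    using assms(7) by (simp add: scalar_prod_sample_vec nn_integral_eq_integral)
  also have "\<dots> \<le> ennreal (2 * M\<^sup>2 * (\<Sum>i<p. \<Sum>j<p. (A $$ (i, j))\<^sup>2))"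
    using assms(8) by (intro ennreal_leI quadratic_form_square) simp
  finally show ?thesis
    using assms(7) by (simp add: mat_trace_mult_transpose)
qed

end
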